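(* Let $\langle A_0;S_0;T_0;\theta_0\rangle\Longrightarrow^{*}\langle\emptyset;S_n;T_n;\theta_n\rangle$ be an $\textsc{AUnif}$ derivation to a final configuration and let $s\triangleq_x t\in A_0\cup S_0$. Then $x\theta_n\tau\in\mathcal{G}_{\mathtt{Abs}}(s,t)$ for every $\tau\in\Psi(T_n,S_n)$.
   Context: Terms are built over variables $\mathcal{V}$ and function symbols $\mathcal{F}$ containing a special constant $\star$ (wild card); $\mathcal{V}(t)$ is the variable set of $t$; $head(x)=x$, $head(f(t_1,\dots,t_n))=f$. Substitutions are postfix; $\mathit{Dom}(\sigma)=\{x\mid x\sigma\neq x\}$; $\mathit{Rvar}(\sigma)$ is the set of variables in its range. An absorption theory $\mathtt{Abs}$ is a finite union of axiom sets $\{f(x,\varepsilon_f)\approx\varepsilon_f, f(\varepsilon_f,x)\approx\varepsilon_f\}$ for pairwise distinct binary $f$; $f,\varepsilon_f$ are related absorption symbols; $\approx_{\mathtt{Abs}}$ the induced equality; $r\preceq_{\mathtt{Abs}}s$ iff $r\sigma\approx_{\mathtt{Abs}}s$ for some $\sigma$; $\mathcal{G}_{\mathtt{Abs}}(s,t)=\{r\mid r\preceq_{\mathtt{Abs}}s,\ r\preceq_{\mathtt{Abs}}t\}$. A term is in $\mathtt{Abs}$-normal form if no $\varepsilon_f$ occurs as an argument of $f$. An AUE is $s\triangleq_x t$ with label $x$; valid sets have pairwise distinct labels; wild AUE: a side is $\star$; solved AUE: $head(s)\neq head(t)$, not related absorption symbols, not wild. A configuration $\langle A;S;T;\theta\rangle$: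 $A$ valid set of AUEs, $S$ valid set of solved AUEs, $T$ valid set of wild AUEs, $\theta$ a substitution, all terms $\mathtt{Abs}$-normal, $labels(A),labels(S),labels(T),\mathit{Dom}(\theta)$ pairwise disjoint, $\mathit{Rvar}(\theta)=labels(A)\cup labels(S)\cup labels(T)$. Rules of $\textsc{AUnif}$ ($\uplus$ disjoint union; $y_i$ fresh; $f$ in Exp rules an absorption symbol): (Dec) $\langle\{f(s_1,\dots,s_n)\triangleq_x f(t_1,\dots,t_n)\}\uplus A;S;T;\theta\rangle\Longrightarrow\langle\{s_i\triangleq_{y_i}t_i\}_{i=1}^n\cup A;S;T;\theta\{x\mapsto f(y_1,\dots,y_n)\}\rangle$, $n\ge0$. (Sol) $\langle\{s\triangleq_x t\}\uplus A;S;T;\theta\rangle\Longrightarrow\langle A;\{s\triangleq_x t\}\cup S;T;\theta\rangle$ if $head(s)\neq head(t)$ and they are not related absorption symbols. (ExpLA1) $\langle\{\varepsilon_f\triangleq_x f(t_1,t_2)\}\uplus A;S;T;\theta\rangle\Longrightarrow\langle\{\varepsilon_f\triangleq_{y_1}t_1\}\cup A;S;\{\star\triangleq_{y_2}t_2\}\cup T;\theta\{x\mapsto f(y_1,y_2)\}\rangle$. (ExpLA2) same left side $\Longrightarrow\langle\{\varepsilon_f\triangleq_{y_2}t_2\}\cup A;S;\{\star\triangleq_{y_1}t_1\}\cup T;\theta\{x\mapsto f(y_1,y_2)\}\rangle$. (ExpRA1) $\langle\{f(s_1,s_2)\triangleq_x\varepsilon_f\}\uplus A;S;T;\theta\rangle\Longrightarrow\langle\{s_1\triangleq_{y_1}\varepsilon_f\}\cup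 A;S;\{s_2\triangleq_{y_2}\star\}\cup T;\theta\{x\mapsto f(y_1,y_2)\}\rangle$. (ExpRA2) same left side $\Longrightarrow\langle\{s_2\triangleq_{y_2}\varepsilon_f\}\cup A;S;\{s_1\triangleq_{y_1}\star\}\cup T;\theta\{x\mapsto f(y_1,y_2)\}\rangle$. (Mer) $\langle\emptyset;\{s\triangleq_x t,s\triangleq_y t\}\cup S;T;\theta\rangle\Longrightarrow\langle\emptyset;\{s\triangleq_y t\}\cup S;T;\theta\{x\mapsto y\}\rangle$. A final configuration is one reached by a finite derivation to which no rule applies. $\sigma_W=\{y\mapsto s\mid s\triangleq_y t\in W\}$, $\rho_W=\{y\mapsto t\mid s\triangleq_y t\in W\}$. Abstraction set: $\uparrow(t,\sigma)=\{r\mid r\sigma\approx_{\mathtt{Abs}}t,\ r\ \mathtt{Abs}\text{-normal},\ \mathcal{V}(r)\subseteq\mathit{Dom}(\sigma)\}$. $\Psi(T,S)$ is the set of substitutions $\tau$ with $\mathit{Dom}(\tau)=labels(T)$ such that $y\tau\in\uparrow(t,\rho_S)$ if $\star\triangleq_y t\in T$ and $y\tau\in\uparrow(s,\sigma_S)$ if $s\triangleq_y\star\in T$ (so $\Psi(\emptyset,S)=\{\mathrm{id}\}$). *)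

theory Defs
  imports Main
begin

datatype ('f, 'v) trm = Var 'v | Fn 'f "('f, 'v) trm list"

text \<open>The type \<open>'f\<close> is the set of function symbols. An absorption theory is
  given by the finite map \<open>absorb\<close> from each absorption symbol \<open>f\<close> to its
  constant \<open>\<epsilon>\<^sub>f\<close>.\<close>

record 'f abs_sig =
  arity :: "'f \<Rightarrow> nat"
  star :: 'f
  absorb :: "'f \<rightharpoonup> 'f"

definition absorption_theory :: "'f abs_sig \<Rightarrow> bool" where
  "absorption_theory \<Sigma> \<longleftrightarrow>
     arity \<Sigma> (star \<Sigma>) = 0 \<and>
     finite (dom (absorb \<Sigma>)) \<and>
     (\<forall>f e. absorb \<Sigma> f = Some e \<longrightarrow> arity \<Sigma> f = 2 \<and> arity \<Sigma> e = 0)"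

abbreviation wild :: "'f abs_sig \<Rightarrow> ('f, 'v) trm" where
  "wild \<Sigma> \<equiv> Fn (star \<Sigma>) []"

fun wf_trm :: "'f abs_sig \<Rightarrow> ('f, 'v) trm \<Rightarrow> bool" where
  "wf_trm \<Sigma> (Var x) \<longleftrightarrow> True"
| "wf_trm \<Sigma> (Fn f ts) \<longleftrightarrow> length ts = arity \<Sigma> f \<and> (\<forall>t \<in> set ts. wf_trm \<Sigma> t)"

fun vars :: "('f, 'v) trm \<Rightarrow> 'v set" where
  "vars (Var x) = {x}"
| "vars (Fn f ts) = (\<Union>t \<in> set ts. vars t)"

fun head :: "('f, 'v) trm \<Rightarrow> 'v + 'f" where
  "head (Var x) = Inl x"
| "head (Fn f ts) = Inr f"


subsection \<open>Substitutions\<close>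

type_synonym ('f, 'v) subst = "'v \<Rightarrow> ('f, 'v) trm"

fun subst_apply :: "('f, 'v) trm \<Rightarrow> ('f, 'v) subst \<Rightarrow> ('f, 'v) trm" (infixl "\<cdot>" 67) where
  "Var x \<cdot> \<sigma> = \<sigma> x"
| "Fn f ts \<cdot> \<sigma> = Fn f (map (\<lambda>t. t \<cdot> \<sigma>) ts)"

definition subst_compose :: "('f, 'v) subst \<Rightarrow> ('f, 'v) subst \<Rightarrow> ('f, 'v) subst"
    (infixl "\<circ>\<^sub>s" 75) where
  "\<sigma> \<circ>\<^sub>s \<tau> = (\<lambda>x. \<sigma> x \<cdot> \<tau>)"

definition Dom :: "('f, 'v) subst \<Rightarrow> 'v set" where
  "Dom \<sigma> = {x. \<sigma> x \<noteq> Var x}"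

definition Rvar :: "('f, 'v) subst \<Rightarrow> 'v set" where
  "Rvar \<sigma> = (\<Union>x \<in> Dom \<sigma>. vars (\<sigma> x))"

definition is_subst :: "'f abs_sig \<Rightarrow> ('f, 'v) subst \<Rightarrow> bool" where
  "is_subst \<Sigma> \<sigma> \<longleftrightarrow> finite (Dom \<sigma>) \<and> (\<forall>x. wf_trm \<Sigma> (\<sigma> x))"


subsection \<open>Equality modulo absorption\<close>

definition abs_axioms :: "'f abs_sig \<Rightarrow> (('f, 'v) trm \<times> ('f, 'v) trm) set" where
  "abs_axioms \<Sigma> =
     {(Fn f [Var x, Fn e []], Fn e []) | f e x. absorb \<Sigma> f = Some e} \<union>
     {(Fn f [Fn e [], Var x], Fn e []) | f e x. absorb \<Sigma> f = Some e}"

inductive abs_eq :: "'f abs_sig \<Rightarrow> ('f, 'v) trm \<Rightarrow> ('f, 'v) trm \<Rightarrow> bool" for \<Sigma> where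
  abs_eq_ax: "(l, r) \<in> abs_axioms \<Sigma> \<Longrightarrow> is_subst \<Sigma> \<sigma> \<Longrightarrow> abs_eq \<Sigma> (l \<cdot> \<sigma>) (r \<cdot> \<sigma>)"
| abs_eq_refl: "wf_trm \<Sigma> t \<Longrightarrow> abs_eq \<Sigma> t t"
| abs_eq_sym: "abs_eq \<Sigma> s t \<Longrightarrow> abs_eq \<Sigma> t s"
| abs_eq_trans: "abs_eq \<Sigma> s t \<Longrightarrow> abs_eq \<Sigma> t u \<Longrightarrow> abs_eq \<Sigma> s u"
| abs_eq_cong: "length ss = arity \<Sigma> f \<Longrightarrow> list_all2 (abs_eq \<Sigma>) ss ts \<Longrightarrow>
    abs_eq \<Sigma> (Fn f ss) (Fn f ts)"

definition more_general :: "'f abs_sig \<Rightarrow> ('f, 'v) trm \<Rightarrow> ('f, 'v) trm \<Rightarrow> bool" where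
  "more_general \<Sigma> r s \<longleftrightarrow> (\<exists>\<sigma>. is_subst \<Sigma> \<sigma> \<and> abs_eq \<Sigma> (r \<cdot> \<sigma>) s)"

definition generalizations :: "'f abs_sig \<Rightarrow> ('f, 'v) trm \<Rightarrow> ('f, 'v) trm \<Rightarrow> ('f, 'v) trm set" where
  "generalizations \<Sigma> s t =
     {r. wf_trm \<Sigma> r \<and> more_general \<Sigma> r s \<and> more_general \<Sigma> r t}"

fun abs_normal :: "'f abs_sig \<Rightarrow> ('f, 'v) trm \<Rightarrow> bool" where
  "abs_normal \<Sigma> (Var x) \<longleftrightarrow> True"
| "abs_normal \<Sigma> (Fn f ts) \<longleftrightarrow>
     (\<forall>t \<in> set ts. abs_normal \<Sigma> t) \<and>
     (\<forall>e. absorb \<Sigma> f = Some e \<longrightarrow> Fn e [] \<notin> set ts)"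

definition related :: "'f abs_sig \<Rightarrow> 'v + 'f \<Rightarrow> 'v + 'f \<Rightarrow> bool" where
  "related \<Sigma> h k \<longleftrightarrow>
     (\<exists>f e. absorb \<Sigma> f = Some e \<and> (h = Inr f \<and> k = Inr e \<or> h = Inr e \<and> k = Inr f))"


subsection \<open>Anti-unification equations and configurations\<close>

text \<open>\<open>AUE s x t\<close> is the equation between \<open>s\<close> and \<open>t\<close> with label \<open>x\<close>.\<close>

datatype ('f, 'v) aue = AUE (lhs: "('f, 'v) trm") (label: 'v) (rhs: "('f, 'v) trm")

definition labels :: "('f, 'v) aue set \<Rightarrow> 'v set" where
  "labels W = label ` W"

definition aue_vars :: "('f, 'v) aue set \<Rightarrow> 'v set" where
  "aue_vars W = (\<Union>a \<in> W. vars (lhs a) \<union> vars (rhs a))"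

definition valid :: "('f, 'v) aue set \<Rightarrow> bool" where
  "valid W \<longleftrightarrow> inj_on label W"

definition wild_aue :: "'f abs_sig \<Rightarrow> ('f, 'v) aue \<Rightarrow> bool" where
  "wild_aue \<Sigma> a \<longleftrightarrow> lhs a = wild \<Sigma> \<or> rhs a = wild \<Sigma>"

definition solved_aue :: "'f abs_sig \<Rightarrow> ('f, 'v) aue \<Rightarrow> bool" where
  "solved_aue \<Sigma> a \<longleftrightarrow>
     head (lhs a) \<noteq> head (rhs a) \<and>
     \<not> related \<Sigma> (head (lhs a)) (head (rhs a)) \<and>
     \<not> wild_aue \<Sigma> a"

type_synonym ('f, 'v) config =
  "('f, 'v) aue set \<times> ('f, 'v) aue set \<times> ('f, 'v) aue set \<times> ('f, 'v) subst"

fun configuration :: "'f abs_sig \<Rightarrow> ('f, 'v) config \<Rightarrow> bool" where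
  "configuration \<Sigma> (A, S, T, \<theta>) \<longleftrightarrow>
     valid A \<and> valid S \<and> valid T \<and>
     (\<forall>a \<in> S. solved_aue \<Sigma> a) \<and>
     (\<forall>a \<in> T. wild_aue \<Sigma> a) \<and>
     is_subst \<Sigma> \<theta> \<and>
     (\<forall>a \<in> A \<union> S \<union> T. wf_trm \<Sigma> (lhs a) \<and> wf_trm \<Sigma> (rhs a)) \<and>
     (\<forall>a \<in> A \<union> S \<union> T. abs_normal \<Sigma> (lhs a) \<and> abs_normal \<Sigma> (rhs a)) \<and>
     (\<forall>x. abs_normal \<Sigma> (\<theta> x)) \<and>
     labels A \<inter> labels S = {} \<and> labels A \<inter> labels T = {} \<and> labels S \<inter> labels T = {} \<and>
     labels A \<inter> Dom \<theta> = {} \<and> labels S \<inter> Dom \<theta> = {} \<and> labels T \<inter> Dom \<theta> = {} \<and>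
     Rvar \<theta> = labels A \<union> labels S \<union> labels T"

fun config_vars :: "('f, 'v) config \<Rightarrow> 'v set" where
  "config_vars (A, S, T, \<theta>) =
     labels (A \<union> S \<union> T) \<union> aue_vars (A \<union> S \<union> T) \<union> Dom \<theta> \<union> Rvar \<theta>"

definition fresh :: "'v list \<Rightarrow> ('f, 'v) config \<Rightarrow> bool" where
  "fresh ys C \<longleftrightarrow> distinct ys \<and> set ys \<inter> config_vars C = {}"


subsection \<open>The rules of AUnif\<close>

text \<open>Disjoint unions are written as \<open>insert a A\<close> with the premise \<open>a \<notin> A\<close>. In
  \<open>Mer\<close> the labels are distinct and the equation labelled \<open>x\<close> really is removed:
  otherwise the rule would apply forever, or \<open>x\<close> would be both a label and in
  the domain of the new substitution.\<close>

inductive aunif :: "'f abs_sig \<Rightarrow> ('f, 'v) config \<Rightarrow> ('f, 'v) config \<Rightarrow> bool" for \<Sigma> where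
  Dec: "\<lbrakk> AUE (Fn f ss) x (Fn f ts) \<notin> A;
          length ss = length ys; length ts = length ys;
          fresh ys (insert (AUE (Fn f ss) x (Fn f ts)) A, S, T, \<theta>) \<rbrakk> \<Longrightarrow>
    aunif \<Sigma> (insert (AUE (Fn f ss) x (Fn f ts)) A, S, T, \<theta>)
      ({AUE (ss ! i) (ys ! i) (ts ! i) | i. i < length ys} \<union> A, S, T,
       \<theta> \<circ>\<^sub>s Var(x := Fn f (map Var ys)))"
| Sol: "\<lbrakk> AUE s x t \<notin> A; head s \<noteq> head t; \<not> related \<Sigma> (head s) (head t) \<rbrakk> \<Longrightarrow>
    aunif \<Sigma> (insert (AUE s x t) A, S, T, \<theta>) (A, insert (AUE s x t) S, T, \<theta>)"
| ExpLA1: "\<lbrakk> absorb \<Sigma> f = Some e;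
          AUE (Fn e []) x (Fn f [t1, t2]) \<notin> A;
          fresh [y1, y2] (insert (AUE (Fn e []) x (Fn f [t1, t2])) A, S, T, \<theta>) \<rbrakk> \<Longrightarrow>
    aunif \<Sigma> (insert (AUE (Fn e []) x (Fn f [t1, t2])) A, S, T, \<theta>)
      (insert (AUE (Fn e []) y1 t1) A, S, insert (AUE (wild \<Sigma>) y2 t2) T,
       \<theta> \<circ>\<^sub>s Var(x := Fn f [Var y1, Var y2]))"
| ExpLA2: "\<lbrakk> absorb \<Sigma> f = Some e;
          AUE (Fn e []) x (Fn f [t1, t2]) \<notin> A;
          fresh [y1, y2] (insert (AUE (Fn e []) x (Fn f [t1, t2])) A, S, T, \<theta>) \<rbrakk> \<Longrightarrow>
    aunif \<Sigma> (insert (AUE (Fn e []) x (Fn f [t1, t2])) A, S, T, \<theta>)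
      (insert (AUE (Fn e []) y2 t2) A, S, insert (AUE (wild \<Sigma>) y1 t1) T,
       \<theta> \<circ>\<^sub>s Var(x := Fn f [Var y1, Var y2]))"
| ExpRA1: "\<lbrakk> absorb \<Sigma> f = Some e;
          AUE (Fn f [s1, s2]) x (Fn e []) \<notin> A;
          fresh [y1, y2] (insert (AUE (Fn f [s1, s2]) x (Fn e [])) A, S, T, \<theta>) \<rbrakk> \<Longrightarrow>
    aunif \<Sigma> (insert (AUE (Fn f [s1, s2]) x (Fn e [])) A, S, T, \<theta>)
      (insert (AUE s1 y1 (Fn e [])) A, S, insert (AUE s2 y2 (wild \<Sigma>)) T,
       \<theta> \<circ>\<^sub>s Var(x := Fn f [Var y1, Var y2]))"
| ExpRA2: "\<lbrakk> absorb \<Sigma> f = Some e;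
          AUE (Fn f [s1, s2]) x (Fn e []) \<notin> A;
          fresh [y1, y2] (insert (AUE (Fn f [s1, s2]) x (Fn e [])) A, S, T, \<theta>) \<rbrakk> \<Longrightarrow>
    aunif \<Sigma> (insert (AUE (Fn f [s1, s2]) x (Fn e [])) A, S, T, \<theta>)
      (insert (AUE s2 y2 (Fn e [])) A, S, insert (AUE s1 y1 (wild \<Sigma>)) T,
       \<theta> \<circ>\<^sub>s Var(x := Fn f [Var y1, Var y2]))"
| Mer: "\<lbrakk> x \<noteq> y; AUE s x t \<notin> S \<rbrakk> \<Longrightarrow>
    aunif \<Sigma> ({}, insert (AUE s x t) (insert (AUE s y t) S), T, \<theta>)
      ({}, insert (AUE s y t) S, T, \<theta> \<circ>\<^sub>s Var(x := Var y))"

definition final :: "'f abs_sig \<Rightarrow> ('f, 'v) config \<Rightarrow> bool" where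
  "final \<Sigma> C \<longleftrightarrow> \<not> (\<exists>C'. aunif \<Sigma> C C')"


subsection \<open>Abstraction sets\<close>

text \<open>The definite descriptions below are meaningful for valid sets of equations.\<close>

definition lsubst :: "('f, 'v) aue set \<Rightarrow> ('f, 'v) subst" where
  "lsubst W y = (if y \<in> labels W then lhs (THE a. a \<in> W \<and> label a = y) else Var y)"

definition rsubst :: "('f, 'v) aue set \<Rightarrow> ('f, 'v) subst" where
  "rsubst W y = (if y \<in> labels W then rhs (THE a. a \<in> W \<and> label a = y) else Var y)"

definition abstraction_set :: "'f abs_sig \<Rightarrow> ('f, 'v) trm \<Rightarrow> ('f, 'v) subst \<Rightarrow> ('f, 'v) trm set" where
  "abstraction_set \<Sigma> t \<sigma> =
     {r. wf_trm \<Sigma> r \<and> abs_eq \<Sigma> (r \<cdot> \<sigma>) t \<and> abs_normal \<Sigma> r \<and> vars r \<subseteq> Dom \<sigma>}"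

definition Psi :: "'f abs_sig \<Rightarrow> ('f, 'v) aue set \<Rightarrow> ('f, 'v) aue set \<Rightarrow> ('f, 'v) subst set" where
  "Psi \<Sigma> T S =
     {\<tau>. is_subst \<Sigma> \<tau> \<and> Dom \<tau> = labels T \<and>
        (\<forall>y t. AUE (wild \<Sigma>) y t \<in> T \<longrightarrow> \<tau> y \<in> abstraction_set \<Sigma> t (rsubst S)) \<and>
        (\<forall>y s. AUE s y (wild \<Sigma>) \<in> T \<longrightarrow> \<tau> y \<in> abstraction_set \<Sigma> s (lsubst S))}"

end

theory Submission
  imports Defs
begin

text \<open>Each rule composes \<open>\<theta>\<close> with an elementary substitution \<open>\<delta>\<close>. Call \<open>\<sigma>\<close> a left solution of a
  configuration if it sends the label of every equation in \<open>A \<union> S\<close>, and of every equation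
  \<open>s \<triangleq> \<star>\<close> in \<open>T\<close>, to its left side modulo absorption; right solutions are defined dually. If \<open>\<sigma>\<close>
  solves the configuration after a step, then \<open>\<delta> \<circ>\<^sub>s \<sigma>\<close> solves the one before it: in the expansion
  rules the argument without obligation is absorbed by the other one, which becomes
  \<open>\<epsilon>\<^sub>f\<close>. For \<open>\<tau>\<close> in \<open>\<Psi>(T, S)\<close> the substitutions \<open>\<tau> \<circ>\<^sub>s \<sigma>\<^sub>S\<close> and \<open>\<tau> \<circ>\<^sub>s \<rho>\<^sub>S\<close> solve the final
  configuration, and pulling them back to the initial one gives the claim.\<close>

section \<open>Substitutions on well-formed terms\<close>

text \<open>Substitutions pulled back through the rules are tracked for well-formedness only.
  Finiteness of the domain, the other half of \<open>is_subst\<close>, is established at the end for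
  the two witnesses \<open>lsubst Sn\<close> and \<open>rsubst Sn\<close>.\<close>

definition wf_subst :: "'f abs_sig \<Rightarrow> ('f, 'v) subst \<Rightarrow> bool" where
  "wf_subst \<Sigma> \<sigma> \<longleftrightarrow> (\<forall>x. wf_trm \<Sigma> (\<sigma> x))"

lemma wf_subst_apply: "wf_trm \<Sigma> t \<Longrightarrow> wf_subst \<Sigma> \<sigma> \<Longrightarrow> wf_trm \<Sigma> (t \<cdot> \<sigma>)"
  by (induction t) (auto simp: wf_subst_def)

lemma wf_subst_compose: "wf_subst \<Sigma> \<sigma> \<Longrightarrow> wf_subst \<Sigma> \<tau> \<Longrightarrow> wf_subst \<Sigma> (\<sigma> \<circ>\<^sub>s \<tau>)"
  by (simp add: wf_subst_def subst_compose_def wf_subst_apply)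

lemma wf_subst_Var_upd: "wf_trm \<Sigma> t \<Longrightarrow> wf_subst \<Sigma> (Var(x := t))"
  by (simp add: wf_subst_def)

lemma wf_subst_compose_upd:
  "wf_subst \<Sigma> \<sigma> \<Longrightarrow> wf_trm \<Sigma> t \<Longrightarrow> wf_subst \<Sigma> (\<sigma> \<circ>\<^sub>s Var(x := t))"
  by (simp add: wf_subst_compose wf_subst_Var_upd)

lemma subst_compose_apply: "(\<sigma> \<circ>\<^sub>s \<tau>) x = \<sigma> x \<cdot> \<tau>"
  by (simp add: subst_compose_def)

lemma subst_apply_Var [simp]: "t \<cdot> Var = t"
  by (induction t) (auto intro: map_idI)

lemma subst_apply_compose: "t \<cdot> (\<sigma> \<circ>\<^sub>s \<tau>) = t \<cdot> \<sigma> \<cdot> \<tau>"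
  by (induction t) (auto simp: subst_compose_def)

lemma subst_compose_assoc: "\<sigma> \<circ>\<^sub>s \<tau> \<circ>\<^sub>s \<upsilon> = \<sigma> \<circ>\<^sub>s (\<tau> \<circ>\<^sub>s \<upsilon>)"
  by (simp add: subst_compose_def fun_eq_iff flip: subst_apply_compose)

lemma subst_compose_Var [simp]: "\<sigma> \<circ>\<^sub>s Var = \<sigma>" "Var \<circ>\<^sub>s \<sigma> = \<sigma>"
  by (simp_all add: subst_compose_def)

lemma is_subst_Var_upd: "wf_trm \<Sigma> t \<Longrightarrow> is_subst \<Sigma> (Var(x := t))"
  by (auto simp: is_subst_def Dom_def intro: finite_subset[of _ "{x}"])

section \<open>Absorption below equality modulo the theory\<close>

text \<open>Congruence first replaces \<open>u\<close> by the constant itself; the result is the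
  instance of an axiom in which the axiom variable is bound to \<open>v\<close>.\<close>

lemma abs_eq_absorb_left:
  assumes "absorption_theory \<Sigma>" "absorb \<Sigma> f = Some e" "abs_eq \<Sigma> u (Fn e [])" "wf_trm \<Sigma> v"
  shows "abs_eq \<Sigma> (Fn f [u, v]) (Fn e [])"
proof -
  have "abs_eq \<Sigma> (Fn f [u, v]) (Fn f [Fn e [], v])"
    using assms by (intro abs_eq_cong) (auto simp: absorption_theory_def intro: abs_eq_refl)
  moreover have "abs_eq \<Sigma> (Fn f [Fn e [], Var x] \<cdot> Var(x := v)) (Fn e [] \<cdot> Var(x := v))" for x
    using assms by (intro abs_eq_ax is_subst_Var_upd) (auto simp: abs_axioms_def)
  ultimately show ?thesis
    by (auto intro: abs_eq_trans)
qed

lemma abs_eq_absorb_right: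
  assumes "absorption_theory \<Sigma>" "absorb \<Sigma> f = Some e" "abs_eq \<Sigma> u (Fn e [])" "wf_trm \<Sigma> v"
  shows "abs_eq \<Sigma> (Fn f [v, u]) (Fn e [])"
proof -
  have "abs_eq \<Sigma> (Fn f [v, u]) (Fn f [v, Fn e []])"
    using assms by (intro abs_eq_cong) (auto simp: absorption_theory_def intro: abs_eq_refl)
  moreover have "abs_eq \<Sigma> (Fn f [Var x, Fn e []] \<cdot> Var(x := v)) (Fn e [] \<cdot> Var(x := v))" for x
    using assms by (intro abs_eq_ax is_subst_Var_upd) (auto simp: abs_axioms_def)
  ultimately show ?thesis
    by (auto intro: abs_eq_trans)
qed

section \<open>An invariant of the rules\<close>

text \<open>The part of being a configuration that \<open>aunif\<close> preserves: \<open>Sol\<close> may move a wild equation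
  into the solved set.\<close>

fun pre_config :: "'f abs_sig \<Rightarrow> ('f, 'v) config \<Rightarrow> bool" where
  "pre_config \<Sigma> (A, S, T, \<theta>) \<longleftrightarrow>
     inj_on label (A \<union> S \<union> T) \<and> A \<inter> S = {} \<and> (A \<union> S) \<inter> T = {} \<and> finite (A \<union> S \<union> T) \<and>
     (\<forall>a \<in> A \<union> S \<union> T. wf_trm \<Sigma> (lhs a) \<and> wf_trm \<Sigma> (rhs a)) \<and> wf_subst \<Sigma> \<theta>"

lemma finite_vars: "finite (vars t)"
  by (induction t) auto

text \<open>Validity of each component and disjointness of the label sets make labels unique
  overall. Finiteness comes from \<theta>: the labels are exactly \<open>Rvar \<theta>\<close>,
  which is finite because \<open>Dom \<theta>\<close> is, and \<open>label\<close> is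
  injective.\<close>

lemma configuration_imp_pre_config:
  assumes "configuration \<Sigma> (A, S, T, \<theta>)"
  shows "pre_config \<Sigma> (A, S, T, \<theta>)"
proof -
  have inj: "inj_on label (A \<union> S \<union> T)"
    using assms by (auto simp: valid_def labels_def inj_on_Un)
  have "finite (Dom \<theta>)"
    using assms by (simp add: is_subst_def)
  then have "finite (Rvar \<theta>)"
    by (simp add: Rvar_def finite_vars)
  moreover have "label ` (A \<union> S \<union> T) = Rvar \<theta>"
    using assms by (simp add: labels_def image_Un)
  ultimately have "finite (A \<union> S \<union> T)"
    using inj by (metis finite_imageD)
  moreover have "A \<inter> S = {}" "(A \<union> S) \<inter> T = {}"
    using assms by (auto simp: labels_def)
  ultimately show ?thesis
    using inj assms by (simp add: is_subst_def wf_subst_def)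
qed

text \<open>Serves the rules that introduce fresh labels: \<open>a\<close> is the equation consumed,
  \<open>W\<close> collects the surviving ones and \<open>N\<close> the new ones.\<close>

lemma inj_on_label_replace:
  assumes "inj_on label (insert a W)" "inj_on label N" "label ` N \<inter> label ` W = {}"
  shows "inj_on label (N \<union> W)"
  using assms by (auto simp: inj_on_Un)

lemma fresh_labels: "fresh ys (A, S, T, \<theta>) \<Longrightarrow> distinct ys \<and> set ys \<inter> label ` (A \<union> S \<union> T) = {}"
  by (auto simp: fresh_def labels_def)

text \<open>Treats the four expansion rules at once: \<open>b\<close> is the new equation to be
  processed, \<open>c\<close> the new wild one, and the disjunction on labels covers both ways of
  distributing \<open>y1\<close> and \<open>y2\<close>.\<close>

lemma pre_config_expand:
  assumes "pre_config \<Sigma> (insert a A, S, T, \<theta>)"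
    and "fresh [y1, y2] (insert a A, S, T, \<theta>)"
    and "wf_subst \<Sigma> \<delta>"
    and "label b = y1 \<and> label c = y2 \<or> label b = y2 \<and> label c = y1"
    and "\<forall>d \<in> {b, c}. wf_trm \<Sigma> (lhs d) \<and> wf_trm \<Sigma> (rhs d)"
  shows "pre_config \<Sigma> (insert b A, S, insert c T, \<theta> \<circ>\<^sub>s \<delta>)"
proof -
  have y: "y1 \<noteq> y2" "{y1, y2} \<inter> label ` (A \<union> S \<union> T) = {}"
    using fresh_labels[OF assms(2)] by auto
  then have "label ` {b, c} \<inter> label ` (A \<union> S \<union> T) = {}" "inj_on label {b, c}"
    using assms(4) by auto
  moreover have "inj_on label (insert a (A \<union> S \<union> T))"
    using assms(1) by simp
  ultimately have "inj_on label ({b, c} \<union> (A \<union> S \<union> T))"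
    by (metis inj_on_label_replace)
  moreover have "{b, c} \<union> (A \<union> S \<union> T) = insert b A \<union> S \<union> insert c T"
    by auto
  ultimately have "inj_on label (insert b A \<union> S \<union> insert c T)"
    by (simp only:)
  moreover have "b \<notin> S \<union> T" "c \<notin> A \<union> S" "b \<noteq> c"
    using assms(4) y by auto
  moreover have "A \<inter> S = {}" "(A \<union> S) \<inter> T = {}" "finite (A \<union> S \<union> T)" "wf_subst \<Sigma> \<theta>"
    "\<forall>a \<in> A \<union> S \<union> T. wf_trm \<Sigma> (lhs a) \<and> wf_trm \<Sigma> (rhs a)"
    using assms(1) by simp_all
  ultimately show ?thesis
    using assms(3,5) by (simp add: wf_subst_compose del: inj_on_insert)
qed

section \<open>Solutions and their pull-back along a step\<close>

text \<open>\<open>p\<close> and \<open>q\<close> are \<open>lhs\<close> and \<open>rhs\<close> in either order, giving left and right solutions.\<close>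

fun solution :: "'f abs_sig \<Rightarrow> (('f, 'v) aue \<Rightarrow> ('f, 'v) trm) \<Rightarrow> (('f, 'v) aue \<Rightarrow> ('f, 'v) trm) \<Rightarrow>
    ('f, 'v) config \<Rightarrow> ('f, 'v) subst \<Rightarrow> bool" where
  "solution \<Sigma> p q (A, S, T, \<theta>) \<sigma> \<longleftrightarrow>
     wf_subst \<Sigma> \<sigma> \<and>
     (\<forall>a \<in> A \<union> S. abs_eq \<Sigma> (\<sigma> (label a)) (p a)) \<and>
     (\<forall>a \<in> T. q a = wild \<Sigma> \<longrightarrow> abs_eq \<Sigma> (\<sigma> (label a)) (p a))"

text \<open>Here \<open>a\<close> is the equation consumed by a step and \<open>W\<close> the rest
  of \<open>A \<union> S\<close>. As labels are unique, binding the label of \<open>a\<close> leaves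
  all other labels fixed, so their obligations are inherited from the later configuration; only the
  obligation of \<open>a\<close> is new, and \<open>eq\<close> supplies it.\<close>

lemma solution_pull_back:
  assumes sol: "solution \<Sigma> p q (A', S', T', \<theta>') \<sigma>"
    and pre: "pre_config \<Sigma> (A, S, T, \<theta>)" "A \<union> S = insert a W" "a \<notin> W"
    and sub: "W \<subseteq> A' \<union> S'" "T \<subseteq> T'"
    and wf: "wf_trm \<Sigma> u"
    and eq: "abs_eq \<Sigma> (u \<cdot> \<sigma>) (p a)"
  shows "solution \<Sigma> p q (A, S, T, \<theta>) (Var(label a := u) \<circ>\<^sub>s \<sigma>)"
proof -
  \<comment> \<open>Injectivity of \<open>label\<close> on the union would still allow one equation
    to lie in two components; disjointness of the components excludes this.\<close>
  have "a \<notin> T"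
    using pre by auto
  then have "label b \<noteq> label a" if "b \<in> W \<union> T" for b
    using pre that by (auto simp: inj_on_def)
  moreover have "wf_subst \<Sigma> (Var(label a := u) \<circ>\<^sub>s \<sigma>)"
    using sol wf by (simp add: wf_subst_compose wf_subst_Var_upd)
  ultimately show ?thesis
    using sol sub eq unfolding solution.simps pre(2) by (auto simp: subst_compose_def)
qed

text \<open>One \<delta> must serve both sides, because the same generalization is to be
  instantiated to the left and to the right term. Including the invariant for \<open>C'\<close> lets
  the relation be chained along a derivation.\<close>

definition reflects_solutions :: "'f abs_sig \<Rightarrow> ('f, 'v) config \<Rightarrow> ('f, 'v) config \<Rightarrow> bool" where
  "reflects_solutions \<Sigma> C C' \<longleftrightarrow> pre_config \<Sigma> C' \<and>
     (\<exists>\<delta>. snd (snd (snd C')) = snd (snd (snd C)) \<circ>\<^sub>s \<delta> \<and>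
       (\<forall>\<sigma>. (solution \<Sigma> lhs rhs C' \<sigma> \<longrightarrow> solution \<Sigma> lhs rhs C (\<delta> \<circ>\<^sub>s \<sigma>)) \<and>
            (solution \<Sigma> rhs lhs C' \<sigma> \<longrightarrow> solution \<Sigma> rhs lhs C (\<delta> \<circ>\<^sub>s \<sigma>))))"

lemma reflects_solutions_trans:
  assumes "reflects_solutions \<Sigma> C C'" "reflects_solutions \<Sigma> C' C''"
  shows "reflects_solutions \<Sigma> C C''"
proof -
  obtain \<delta> where \<delta>: "snd (snd (snd C')) = snd (snd (snd C)) \<circ>\<^sub>s \<delta>"
    "\<And>\<sigma>. solution \<Sigma> lhs rhs C' \<sigma> \<Longrightarrow> solution \<Sigma> lhs rhs C (\<delta> \<circ>\<^sub>s \<sigma>)"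
    "\<And>\<sigma>. solution \<Sigma> rhs lhs C' \<sigma> \<Longrightarrow> solution \<Sigma> rhs lhs C (\<delta> \<circ>\<^sub>s \<sigma>)"
    using assms(1) unfolding reflects_solutions_def by blast
  obtain \<delta>' where \<delta>': "snd (snd (snd C'')) = snd (snd (snd C')) \<circ>\<^sub>s \<delta>'"
    "\<And>\<sigma>. solution \<Sigma> lhs rhs C'' \<sigma> \<Longrightarrow> solution \<Sigma> lhs rhs C' (\<delta>' \<circ>\<^sub>s \<sigma>)"
    "\<And>\<sigma>. solution \<Sigma> rhs lhs C'' \<sigma> \<Longrightarrow> solution \<Sigma> rhs lhs C' (\<delta>' \<circ>\<^sub>s \<sigma>)"
    using assms(2) unfolding reflects_solutions_def by blast
  show ?thesis
    using assms(2) \<delta> \<delta>' unfolding reflects_solutions_def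
    by (auto intro!: exI[of _ "\<delta> \<circ>\<^sub>s \<delta>'"] simp: subst_compose_assoc)
qed

text \<open>Common form of all rules that extend \<theta>; what remains specific to a rule is that
  \<open>u\<close> solves the equation \<open>a\<close> on both sides. The condition on
  \<open>A \<union> S\<close> lets \<open>a\<close> come from \<open>A\<close>, as in decomposition
  and expansion, or from \<open>S\<close>, as in merging. Since \<open>solution\<close> ignores the
  substitution component, \<open>left\<close> and \<open>right\<close> can be stated with the old
  \<theta>.\<close>

lemma reflects_solutions_bind:
  assumes pre: "pre_config \<Sigma> (A, S, T, \<theta>)" "A \<union> S = insert a W" "a \<notin> W"
    and sub: "W \<subseteq> A' \<union> S'" "T \<subseteq> T'"
    and wf: "wf_trm \<Sigma> u"
    and pre': "pre_config \<Sigma> (A', S', T', \<theta> \<circ>\<^sub>s Var(label a := u))"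
    and left: "\<And>\<sigma>. solution \<Sigma> lhs rhs (A', S', T', \<theta>) \<sigma> \<Longrightarrow> abs_eq \<Sigma> (u \<cdot> \<sigma>) (lhs a)"
    and right: "\<And>\<sigma>. solution \<Sigma> rhs lhs (A', S', T', \<theta>) \<sigma> \<Longrightarrow> abs_eq \<Sigma> (u \<cdot> \<sigma>) (rhs a)"
  shows "reflects_solutions \<Sigma> (A, S, T, \<theta>) (A', S', T', \<theta> \<circ>\<^sub>s Var(label a := u))"
proof -
  have "solution \<Sigma> lhs rhs (A, S, T, \<theta>) (Var(label a := u) \<circ>\<^sub>s \<sigma>)"
    if "solution \<Sigma> lhs rhs (A', S', T', \<theta> \<circ>\<^sub>s Var(label a := u)) \<sigma>" for \<sigma>
    using solution_pull_back[OF that pre sub wf] that left by simp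
  moreover have "solution \<Sigma> rhs lhs (A, S, T, \<theta>) (Var(label a := u) \<circ>\<^sub>s \<sigma>)"
    if "solution \<Sigma> rhs lhs (A', S', T', \<theta> \<circ>\<^sub>s Var(label a := u)) \<sigma>" for \<sigma>
    using solution_pull_back[OF that pre sub wf] that right by simp
  ultimately show ?thesis
    unfolding reflects_solutions_def using pre' by (metis snd_conv)
qed

section \<open>The individual rules\<close>

text \<open>A solution sends each fresh variable to the corresponding argument modulo absorption,
  and congruence for \<open>f\<close> reassembles the decomposed term.\<close>

lemma reflects_solutions_Dec:
  assumes pre: "pre_config \<Sigma> (insert (AUE (Fn f ss) x (Fn f ts)) A, S, T, \<theta>)"
    and notin: "AUE (Fn f ss) x (Fn f ts) \<notin> A"
    and len: "length ss = length ys" "length ts = length ys"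
    and fresh: "fresh ys (insert (AUE (Fn f ss) x (Fn f ts)) A, S, T, \<theta>)"
  shows "reflects_solutions \<Sigma> (insert (AUE (Fn f ss) x (Fn f ts)) A, S, T, \<theta>)
    ({AUE (ss ! i) (ys ! i) (ts ! i) | i. i < length ys} \<union> A, S, T,
     \<theta> \<circ>\<^sub>s Var(x := Fn f (map Var ys)))"
proof -
  define a where "a = AUE (Fn f ss) x (Fn f ts)"
  define N where "N = {AUE (ss ! i) (ys ! i) (ts ! i) | i. i < length ys}"
  \<comment> \<open>Written as an image of an index range, \<open>N\<close> is visibly finite, and
    its labels are injective because \<open>ys\<close> is distinct.\<close>
  have N_image: "N = (\<lambda>i. AUE (ss ! i) (ys ! i) (ts ! i)) ` {..<length ys}"
    by (auto simp: N_def)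
  have ys: "distinct ys" "set ys \<inter> label ` (A \<union> S \<union> T) = {}"
    using fresh_labels[OF fresh] by auto
  have labels_N: "label ` N \<subseteq> set ys"
    by (auto simp: N_image)
  have wf: "length ss = arity \<Sigma> f" "\<And>s. s \<in> set ss \<Longrightarrow> wf_trm \<Sigma> s" "\<And>t. t \<in> set ts \<Longrightarrow> wf_trm \<Sigma> t"
    using pre by auto
  have a_notin: "a \<notin> A \<union> S"
    using pre notin by (auto simp: a_def)
  have sub: "A \<union> S \<subseteq> N \<union> A \<union> S"
    by blast
  have "wf_trm \<Sigma> (Fn f (map Var ys))"
    using wf len by simp
  moreover have "pre_config \<Sigma> (N \<union> A, S, T, \<theta> \<circ>\<^sub>s Var(x := Fn f (map Var ys)))"
  proof -
    have "inj_on label N"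
      using ys(1) by (auto simp: N_image inj_on_def nth_eq_iff_index_eq)
    moreover have disj: "label ` N \<inter> label ` (A \<union> S \<union> T) = {}"
      using ys(2) labels_N by auto
    ultimately have "inj_on label (N \<union> (A \<union> S \<union> T))"
      using pre by (intro inj_on_label_replace[where a = a]) (auto simp: a_def)
    moreover have "N \<inter> (S \<union> T) = {}"
      using disj by auto
    moreover have "finite N"
      by (simp add: N_image)
    moreover have "wf_trm \<Sigma> (lhs b) \<and> wf_trm \<Sigma> (rhs b)" if "b \<in> N" for b
      using that wf len by (auto simp: N_def)
    moreover have "wf_subst \<Sigma> (\<theta> \<circ>\<^sub>s Var(x := Fn f (map Var ys)))"
      using pre \<open>wf_trm \<Sigma> (Fn f (map Var ys))\<close> by (simp add: wf_subst_compose_upd)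
    ultimately show ?thesis
      using pre by (auto simp: Un_assoc)
  qed
  moreover have "abs_eq \<Sigma> (Fn f (map Var ys) \<cdot> \<sigma>) (Fn f ss)"
    if "solution \<Sigma> lhs rhs (N \<union> A, S, T, \<theta>) \<sigma>" for \<sigma>
  proof -
    have "abs_eq \<Sigma> (\<sigma> (ys ! i)) (ss ! i)" if "i < length ys" for i
      using \<open>solution _ _ _ _ _\<close> that by (force simp: N_image)
    then show ?thesis
      using wf len by (auto intro!: abs_eq_cong simp: list_all2_conv_all_nth)
  qed
  moreover have "abs_eq \<Sigma> (Fn f (map Var ys) \<cdot> \<sigma>) (Fn f ts)"
    if "solution \<Sigma> rhs lhs (N \<union> A, S, T, \<theta>) \<sigma>" for \<sigma>
  proof -
    have "abs_eq \<Sigma> (\<sigma> (ys ! i)) (ts ! i)" if "i < length ys" for i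
      using \<open>solution _ _ _ _ _\<close> that by (force simp: N_image)
    then show ?thesis
      using wf len by (auto intro!: abs_eq_cong simp: list_all2_conv_all_nth)
  qed
  ultimately have "reflects_solutions \<Sigma> (insert a A, S, T, \<theta>)
      (N \<union> A, S, T, \<theta> \<circ>\<^sub>s Var(x := Fn f (map Var ys)))"
    using reflects_solutions_bind[of \<Sigma> "insert a A" S T \<theta> a "A \<union> S" "N \<union> A" S T "Fn f (map Var ys)"]
      pre notin a_notin sub
    by (simp add: a_def del: pre_config.simps solution.simps)
  then show ?thesis
    by (simp only: a_def N_def)
qed

text \<open>Obligations for \<open>A\<close> and \<open>S\<close> enter only through
  \<open>A \<union> S\<close>, which the rule leaves unchanged, so \<delta> is the identity.\<close>

lemma reflects_solutions_Sol:
  assumes "pre_config \<Sigma> (insert a A, S, T, \<theta>)" "a \<notin> A"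
  shows "reflects_solutions \<Sigma> (insert a A, S, T, \<theta>) (A, insert a S, T, \<theta>)"
proof -
  have "insert a A \<union> S = A \<union> insert a S"
    by simp
  with assms show ?thesis
    by (auto simp: reflects_solutions_def intro!: exI[of _ Var])
qed

text \<open>Isolates what differs between the four expansion rules, namely \<open>left\<close> and
  \<open>right\<close>. On the side of the compound term both \<open>b\<close> and \<open>c\<close>
  impose obligations, so congruence applies. On the side of the constant, \<open>b\<close> forces
  one argument to be \<open>\<epsilon>\<^sub>f\<close>, which absorbs whatever the other argument
  is.\<close>

lemma reflects_solutions_Exp:
  assumes "absorption_theory \<Sigma>" "absorb \<Sigma> f = Some e"
    and pre: "pre_config \<Sigma> (insert a A, S, T, \<theta>)" "a \<notin> A"
    and fresh: "fresh [y1, y2] (insert a A, S, T, \<theta>)"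
    and labels: "label b = y1 \<and> label c = y2 \<or> label b = y2 \<and> label c = y1"
    and wf: "\<forall>d \<in> {b, c}. wf_trm \<Sigma> (lhs d) \<and> wf_trm \<Sigma> (rhs d)"
    and left: "\<And>\<sigma>. solution \<Sigma> lhs rhs (insert b A, S, insert c T, \<theta>) \<sigma> \<Longrightarrow>
      abs_eq \<Sigma> (Fn f [\<sigma> y1, \<sigma> y2]) (lhs a)"
    and right: "\<And>\<sigma>. solution \<Sigma> rhs lhs (insert b A, S, insert c T, \<theta>) \<sigma> \<Longrightarrow>
      abs_eq \<Sigma> (Fn f [\<sigma> y1, \<sigma> y2]) (rhs a)"
  shows "reflects_solutions \<Sigma> (insert a A, S, T, \<theta>)
    (insert b A, S, insert c T, \<theta> \<circ>\<^sub>s Var(label a := Fn f [Var y1, Var y2]))"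
proof -
  have "wf_trm \<Sigma> (Fn f [Var y1, Var y2])"
    using assms(1,2) by (auto simp: absorption_theory_def)
  with pre fresh labels wf left right show ?thesis
    by (intro reflects_solutions_bind[where W = "A \<union> S"] pre_config_expand wf_subst_Var_upd) auto
qed

lemma aunif_reflects_solutions:
  assumes abs: "absorption_theory \<Sigma>" and "pre_config \<Sigma> C" and "aunif \<Sigma> C C'"
  shows "reflects_solutions \<Sigma> C C'"
  using assms(3,2)
proof cases
  case Dec
  with assms(2) show ?thesis
    by (auto intro!: reflects_solutions_Dec simp del: pre_config.simps)
next
  case Sol
  with assms(2) show ?thesis
    by (auto intro!: reflects_solutions_Sol simp del: pre_config.simps)
next
  case (ExpLA1 f e x t1 t2 A y1 y2 S T \<theta>)
  define a b c where "a = AUE (Fn e []) x (Fn f [t1, t2])"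
    and "b = AUE (Fn e []) y1 t1" and "c = AUE (wild \<Sigma>) y2 t2"
  \<comment> \<open>The label of \<open>b\<close> is \<open>y1\<close>, so on the left the constant
    is the first argument and \<open>abs_eq_absorb_left\<close> applies. In the other cases, too,
    the position of the label of \<open>b\<close> decides which absorption lemma is used.\<close>
  have "reflects_solutions \<Sigma> (insert a A, S, T, \<theta>)
      (insert b A, S, insert c T, \<theta> \<circ>\<^sub>s Var(label a := Fn f [Var y1, Var y2]))"
    using assms(2) ExpLA1 abs
    by (intro reflects_solutions_Exp[where e = e])
      (auto simp: a_def b_def c_def absorption_theory_def wf_subst_def
        intro: abs_eq_cong intro!: abs_eq_absorb_left)
  then show ?thesis
    using ExpLA1 by (simp add: a_def b_def c_def)
next
  case (ExpLA2 f e x t1 t2 A y1 y2 S T \<theta>)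
  define a b c where "a = AUE (Fn e []) x (Fn f [t1, t2])"
    and "b = AUE (Fn e []) y2 t2" and "c = AUE (wild \<Sigma>) y1 t1"
  have "reflects_solutions \<Sigma> (insert a A, S, T, \<theta>)
      (insert b A, S, insert c T, \<theta> \<circ>\<^sub>s Var(label a := Fn f [Var y1, Var y2]))"
    using assms(2) ExpLA2 abs
    by (intro reflects_solutions_Exp[where e = e])
      (auto simp: a_def b_def c_def absorption_theory_def wf_subst_def
        intro: abs_eq_cong intro!: abs_eq_absorb_right)
  then show ?thesis
    using ExpLA2 by (simp add: a_def b_def c_def)
next
  case (ExpRA1 f e s1 s2 x A y1 y2 S T \<theta>)
  define a b c where "a = AUE (Fn f [s1, s2]) x (Fn e [])"
    and "b = AUE s1 y1 (Fn e [])" and "c = AUE s2 y2 (wild \<Sigma>)"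
  have "reflects_solutions \<Sigma> (insert a A, S, T, \<theta>)
      (insert b A, S, insert c T, \<theta> \<circ>\<^sub>s Var(label a := Fn f [Var y1, Var y2]))"
    using assms(2) ExpRA1 abs
    by (intro reflects_solutions_Exp[where e = e])
      (auto simp: a_def b_def c_def absorption_theory_def wf_subst_def
        intro: abs_eq_cong intro!: abs_eq_absorb_left)
  then show ?thesis
    using ExpRA1 by (simp add: a_def b_def c_def)
next
  case (ExpRA2 f e s1 s2 x A y1 y2 S T \<theta>)
  define a b c where "a = AUE (Fn f [s1, s2]) x (Fn e [])"
    and "b = AUE s2 y2 (Fn e [])" and "c = AUE s1 y1 (wild \<Sigma>)"
  have "reflects_solutions \<Sigma> (insert a A, S, T, \<theta>)
      (insert b A, S, insert c T, \<theta> \<circ>\<^sub>s Var(label a := Fn f [Var y1, Var y2]))"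
    using assms(2) ExpRA2 abs
    by (intro reflects_solutions_Exp[where e = e])
      (auto simp: a_def b_def c_def absorption_theory_def wf_subst_def
        intro: abs_eq_cong intro!: abs_eq_absorb_right)
  then show ?thesis
    using ExpRA2 by (simp add: a_def b_def c_def)
next
  case (Mer x y s t S T \<theta>)
  define a b where "a = AUE s x t" and "b = AUE s y t"
  \<comment> \<open>The surviving equation \<open>b\<close> has the same two sides as
    \<open>a\<close>, so a solution already gives \<open>y\<close> the value that the label of
    \<open>a\<close> must take.\<close>
  have "reflects_solutions \<Sigma> ({}, insert a (insert b S), T, \<theta>)
      ({}, insert b S, T, \<theta> \<circ>\<^sub>s Var(label a := Var y))"
    using assms(2) Mer
    by (intro reflects_solutions_bind[where W = "insert b S"])
      (auto simp: a_def b_def wf_subst_compose_upd)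
  then show ?thesis
    using Mer by (simp add: a_def b_def)
qed

section \<open>Derivations and solutions of their last configuration\<close>

lemma aunif_rtranclp_reflects_solutions:
  assumes "absorption_theory \<Sigma>" "pre_config \<Sigma> C" "(aunif \<Sigma>)\<^sup>*\<^sup>* C C'"
  shows "reflects_solutions \<Sigma> C C'"
  using assms(3)
proof induction
  case base
  show ?case
    using assms(2) by (auto simp: reflects_solutions_def intro!: exI[of _ Var])
next
  case (step C' C'')
  moreover from step.IH have "pre_config \<Sigma> C'"
    by (simp add: reflects_solutions_def)
  ultimately show ?case
    using aunif_reflects_solutions[OF assms(1)] reflects_solutions_trans by blast
qed

lemma lsubst_rsubst_label:
  assumes "inj_on label W" "a \<in> W"
  shows "lsubst W (label a) = lhs a" "rsubst W (label a) = rhs a"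
proof -
  have "(THE b. b \<in> W \<and> label b = label a) = a"
    using assms by (auto simp: inj_on_def)
  with assms show "lsubst W (label a) = lhs a" "rsubst W (label a) = rhs a"
    by (auto simp: lsubst_def rsubst_def labels_def)
qed

text \<open>Both domains lie within the finite set of labels of \<open>W\<close>. This makes the two
  substitutions admissible as witnesses for \<open>more_general\<close>.\<close>

lemma is_subst_lsubst_rsubst:
  assumes "inj_on label W" "finite W" "\<forall>a \<in> W. wf_trm \<Sigma> (lhs a) \<and> wf_trm \<Sigma> (rhs a)"
  shows "is_subst \<Sigma> (lsubst W)" "is_subst \<Sigma> (rsubst W)"
proof -
  have outside: "lsubst W y = Var y \<and> rsubst W y = Var y" if "y \<notin> label ` W" for y
    using that by (simp add: lsubst_def rsubst_def labels_def)
  then have "Dom (lsubst W) \<subseteq> label ` W" "Dom (rsubst W) \<subseteq> label ` W"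
    by (auto simp: Dom_def)
  moreover have "wf_trm \<Sigma> (lsubst W y) \<and> wf_trm \<Sigma> (rsubst W y)" for y
    using assms outside lsubst_rsubst_label[OF assms(1)] by (cases "y \<in> label ` W") auto
  ultimately show "is_subst \<Sigma> (lsubst W)" "is_subst \<Sigma> (rsubst W)"
    using assms(2) by (auto simp: is_subst_def intro: finite_subset)
qed

text \<open>Labels of \<open>S\<close> lie outside \<open>Dom \<tau>\<close>, which is
  \<open>labels T\<close>, so there \<open>lsubst S\<close> and \<open>rsubst S\<close> return the
  sides exactly. For a wild equation, the obligation on its side opposite a wild card is the
  equality in the definition of the abstraction set.\<close>

lemma Psi_solution:
  assumes pre: "pre_config \<Sigma> ({}, S, T, \<theta>)" and \<tau>: "\<tau> \<in> Psi \<Sigma> T S"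
  shows "solution \<Sigma> lhs rhs ({}, S, T, \<theta>) (\<tau> \<circ>\<^sub>s lsubst S)"
    and "solution \<Sigma> rhs lhs ({}, S, T, \<theta>) (\<tau> \<circ>\<^sub>s rsubst S)"
proof -
  have inj: "inj_on label S"
    using pre by (auto intro: inj_on_subset)
  note lr = lsubst_rsubst_label[OF inj]
  have wf: "wf_subst \<Sigma> \<tau>" "wf_subst \<Sigma> (lsubst S)" "wf_subst \<Sigma> (rsubst S)"
    using \<tau> is_subst_lsubst_rsubst[of S \<Sigma>] inj pre by (auto simp: Psi_def is_subst_def wf_subst_def)
  have \<tau>_label: "\<tau> (label a) = Var (label a)" if "a \<in> S" for a
  proof -
    have "label a \<notin> labels T"
      using pre that by (auto simp: labels_def inj_on_def)
    then show ?thesis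
      using \<tau> by (auto simp: Psi_def Dom_def)
  qed
  have refl: "abs_eq \<Sigma> (lhs a) (lhs a)" "abs_eq \<Sigma> (rhs a) (rhs a)" if "a \<in> S" for a
    using pre that by (auto intro: abs_eq_refl)
  have "abs_eq \<Sigma> (\<tau> (label a) \<cdot> lsubst S) (lhs a)" if "a \<in> T" "rhs a = wild \<Sigma>" for a
    using \<tau> that by (cases a) (auto simp: Psi_def abstraction_set_def)
  moreover have "abs_eq \<Sigma> (\<tau> (label a) \<cdot> rsubst S) (rhs a)" if "a \<in> T" "lhs a = wild \<Sigma>" for a
    using \<tau> that by (cases a) (auto simp: Psi_def abstraction_set_def)
  ultimately show "solution \<Sigma> lhs rhs ({}, S, T, \<theta>) (\<tau> \<circ>\<^sub>s lsubst S)"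
    and "solution \<Sigma> rhs lhs ({}, S, T, \<theta>) (\<tau> \<circ>\<^sub>s rsubst S)"
    using wf \<tau>_label refl lr by (auto simp: subst_compose_apply wf_subst_compose)
qed

theorem theorem3:
  fixes \<Sigma> :: "'f abs_sig"
    and A0 S0 T0 Sn Tn :: "('f, 'v) aue set"
    and \<theta>0 \<theta>n :: "('f, 'v) subst"
    and s t :: "('f, 'v) trm" and x :: 'v
  assumes "absorption_theory \<Sigma>"
    and "configuration \<Sigma> (A0, S0, T0, \<theta>0)"
    and "(aunif \<Sigma>)\<^sup>*\<^sup>* (A0, S0, T0, \<theta>0) ({}, Sn, Tn, \<theta>n)"
    and "final \<Sigma> ({}, Sn, Tn, \<theta>n)"
    and "AUE s x t \<in> A0 \<union> S0"
  shows "\<forall>\<tau> \<in> Psi \<Sigma> Tn Sn. \<theta>n x \<cdot> \<tau> \<in> generalizations \<Sigma> s t"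
proof
  fix \<tau> assume \<tau>: "\<tau> \<in> Psi \<Sigma> Tn Sn"
  have refl: "reflects_solutions \<Sigma> (A0, S0, T0, \<theta>0) ({}, Sn, Tn, \<theta>n)"
    using assms(1-3) by (intro aunif_rtranclp_reflects_solutions configuration_imp_pre_config)
  then obtain \<delta> where \<delta>: "\<theta>n = \<theta>0 \<circ>\<^sub>s \<delta>"
    "\<And>\<sigma>. solution \<Sigma> lhs rhs ({}, Sn, Tn, \<theta>n) \<sigma> \<Longrightarrow> solution \<Sigma> lhs rhs (A0, S0, T0, \<theta>0) (\<delta> \<circ>\<^sub>s \<sigma>)"
    "\<And>\<sigma>. solution \<Sigma> rhs lhs ({}, Sn, Tn, \<theta>n) \<sigma> \<Longrightarrow> solution \<Sigma> rhs lhs (A0, S0, T0, \<theta>0) (\<delta> \<circ>\<^sub>s \<sigma>)"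
    unfolding reflects_solutions_def snd_conv by blast
  have pre: "pre_config \<Sigma> ({}, Sn, Tn, \<theta>n)"
    using refl by (simp add: reflects_solutions_def)
  \<comment> \<open>Labels are not in the domain of the initial substitution, so
    \<open>\<theta>0 x\<close> is \<open>Var x\<close> and the computed term at \<open>x\<close> is
    just \<open>\<delta> x\<close>.\<close>
  have "x \<in> labels A0 \<union> labels S0"
    using assms(5) by (force simp: labels_def)
  then have "x \<notin> Dom \<theta>0"
    using assms(2) by auto
  then have "\<theta>n x = \<delta> x"
    using \<delta>(1) by (simp add: subst_compose_def Dom_def)
  \<comment> \<open>The pulled-back solutions
    \<open>\<delta> \<circ>\<^sub>s (\<tau> \<circ>\<^sub>s lsubst Sn)\<close> and
    \<open>\<delta> \<circ>\<^sub>s (\<tau> \<circ>\<^sub>s rsubst Sn)\<close> are evaluated at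
    \<open>x\<close>, the label of the given equation. Reassociating exhibits
    \<open>lsubst Sn\<close> and \<open>rsubst Sn\<close> as the instantiating
    substitutions.\<close>
  then have "abs_eq \<Sigma> (\<theta>n x \<cdot> \<tau> \<cdot> lsubst Sn) s" "abs_eq \<Sigma> (\<theta>n x \<cdot> \<tau> \<cdot> rsubst Sn) t"
    using \<delta>(2)[OF Psi_solution(1)[OF pre \<tau>]] \<delta>(3)[OF Psi_solution(2)[OF pre \<tau>]] assms(5)
    by (force simp: subst_compose_apply subst_apply_compose)+
  moreover have "is_subst \<Sigma> (lsubst Sn)" "is_subst \<Sigma> (rsubst Sn)"
    using pre by (auto intro!: is_subst_lsubst_rsubst intro: inj_on_subset)
  moreover have "wf_trm \<Sigma> (\<theta>n x \<cdot> \<tau>)"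
    using pre \<tau> by (auto intro!: wf_subst_apply simp: wf_subst_def Psi_def is_subst_def)
  ultimately show "\<theta>n x \<cdot> \<tau> \<in> generalizations \<Sigma> s t"
    by (auto simp: generalizations_def more_general_def)
qed

end
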